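(* For $n\geq 1$ let $b_n=4n-1$, $A_n=\{n,\,nb_n,\,nb_n+n\}$, $\alpha_n=\max(A_n)=nb_n+n$, and let $S_{(n)}$ be the binary string obtained by concatenating, for $j=1,2,\ldots,n-1$ in this order, the strings $0^j1^{b_n-j}$ (so $S_{(1)}$ is empty). Then $\operatorname{per}(A_n,S_{(n)})=e^{\Omega(\sqrt{\alpha_n})}$, i.e. there is a constant $c>0$ such that $\operatorname{per}(A_n,S_{(n)})\geq e^{c\sqrt{\alpha_n}}$ for all sufficiently large $n$.
   Context: For a finite nonempty set $A$ of positive integers let $\alpha=\max A$. A seed is a string $S=s_1s_2\cdots s_\alpha\in\{0,1\}^\alpha$; a binary string of length less than $\alpha$ used as a seed is first padded on the left with $1$'s to length $\alpha$. The sequence $w^{A,S}$ is defined by $w^{A,S}(-\alpha-1+j)=s_j$ for $j=1,\ldots,\alpha$ (so $S$ lists $w^{A,S}(-\alpha),\ldots,w^{A,S}(-1)$ in order) and, for $n\geq 0$, $w^{A,S}(n)=1-\min\{w^{A,S}(n-x):x\in A\}$. The sequence $(w^{A,S}(n))_{n\geq 0}$ is periodic over $p\ge 1$ if there is $N\ge 0$ with $w^{A,S}(n)=w^{A,S}(n+p)$ for all $n\geq N$; $\operatorname{per}(A,S)$ is the least such $p$. Notation: $0^j$, $1^j$ denote strings of $j$ zeros/ones. *)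

theory Defs
  imports Complex_Main
begin

definition pad_seed :: "nat set \<Rightarrow> nat list \<Rightarrow> nat list" where
  "pad_seed A S = replicate (Max A - length S) 1 @ S"

text \<open>
  The sequence \<open>w\<^sup>A\<^sup>,\<^sup>S\<close>, for a finite nonempty set \<open>A\<close> of positive integers and a seed \<open>S\<close> over
  \<open>{0, 1}\<close> of length at most \<open>Max A\<close>. Lists are indexed from 0, so the value at \<open>n < 0\<close>, that is
  the letter \<open>s\<^sub>j\<close> with \<open>n = j - 1 - Max A\<close>, is entry \<open>n + Max A\<close> of the padded seed. Indices below
  \<open>- Max A\<close> are irrelevant, and the case \<open>0 \<in> A\<close> only serves to make the recursion terminate.
\<close>

function wseq :: "nat set \<Rightarrow> nat list \<Rightarrow> int \<Rightarrow> nat" where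
  "wseq A S n =
     (if n < 0 then pad_seed A S ! nat (n + int (Max A))
      else if 0 \<in> A then 0
      else 1 - Min ((\<lambda>x. wseq A S (n - int x)) ` A))"
  by auto
termination
proof (relation "measure (\<lambda>(A, S, n). nat (n + 1))", goal_cases)
  case (2 A S n x)
  then have "x \<noteq> 0" by metis
  with 2 show ?case by auto
qed auto

declare wseq.simps [simp del]

definition periodic_over :: "(nat \<Rightarrow> 'a) \<Rightarrow> nat \<Rightarrow> bool" where
  "periodic_over f p \<longleftrightarrow> p \<ge> 1 \<and> (\<exists>N. \<forall>n\<ge>N. f n = f (n + p))"

definition per :: "nat set \<Rightarrow> nat list \<Rightarrow> nat" where
  "per A S = (LEAST p. periodic_over (\<lambda>n. wseq A S (int n)) p)"

definition b_num :: "nat \<Rightarrow> nat" where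
  "b_num n = 4 * n - 1"

definition A_set :: "nat \<Rightarrow> nat set" where
  "A_set n = {n, n * b_num n, n * b_num n + n}"

definition seed :: "nat \<Rightarrow> nat list" where
  "seed n = concat (map (\<lambda>j. replicate j 0 @ replicate (b_num n - j) 1) [1..<n])"

end

theory Submission
  imports Defs
begin

text \<open>
  All elements of \<open>A\<^sub>n\<close> are divisible by \<open>n\<close>, so \<open>w\<close> splits into the \<open>n\<close> strands
  \<open>m \<mapsto> w (n m + r)\<close>, \<open>0 \<le> r < n\<close>, each of which obeys the same recursion with lags \<open>1, b, b + 1\<close>,
  where \<open>b = 4 n - 1\<close>. The seed makes the strand with \<open>k = r + 1\<close> purely periodic with least
  period \<open>P = 2 k b + 1\<close>: since \<open>(- k) (2 b) = 1\<close> modulo \<open>P\<close>, the coordinate \<open>t = - k m\<close> turns the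
  step \<open>2 b\<close> into \<open>+ 1\<close>, and in it the zeros form an explicit family of intervals, which the
  recursion confirms as a tiling statement.

  Every period of \<open>w\<close> is a period of each strand, hence a common multiple of the numbers
  \<open>2 b k + 1\<close>, \<open>1 \<le> k \<le> n\<close>. Any such common multiple \<open>L\<close> satisfies
  \<open>\<Prod>\<^sub>k (2 b k + 1) dvd (n - 1)! L\<close>, so \<open>L \<ge> (2 b)\<^sup>n \<ge> e\<^sup>n\<close>, while \<open>\<surd>\<alpha>\<^sub>n = 2 n\<close>.
\<close>

section \<open>The periodic pattern of a strand\<close>

text \<open>
  Strand \<open>k\<close> is read in the coordinate \<open>t = - k m mod P\<close>, in which the lags \<open>1\<close>, \<open>b\<close> and \<open>b + 1\<close>
  become \<open>+ k\<close>, \<open>+ (4 k n - k)\<close> and \<open>+ 4 k n\<close>, and the zeros form blocks of length \<open>k\<close>. On a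
  period \<open>[0, P)\<close> the blocks start at \<open>c j\<close> and \<open>D + c j\<close> for \<open>0 \<le> j < k\<close>, and at \<open>E + 2 k j\<close>
  for \<open>1 \<le> j \<le> 2 (n - k)\<close>.
\<close>

locale strand =
  fixes n k :: int
  assumes k_pos: "1 \<le> k" and k_le: "k \<le> n"
begin

definition c :: int where "c = 4 * k - 1"
definition D :: int where "D = 4 * (k * n) + k"
definition E :: int where "E = D + c * (k - 1)"
definition P :: int where "P = 2 * k * (4 * n - 1) + 1"

definition win :: "int \<Rightarrow> bool" where
  "win t \<longleftrightarrow> (if t < D then t < c * k \<and> t mod c < k
              else if t < E then (t - D) mod c < k
              else (t - E) mod (2 * k) < k)"

definition Z :: "int \<Rightarrow> bool" where "Z t \<longleftrightarrow> win (t mod P)"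

section \<open>Arithmetic of the constants and values of the pattern\<close>

lemma kn: "k * k \<le> k * n" "k \<le> k * k" "k \<le> k * n"
proof -
  show a: "k * k \<le> k * n" using k_pos k_le by simp
  show b: "k \<le> k * k" using k_pos by simp
  show "k \<le> k * n" using a b by linarith
qed

lemma ck: "c * (k - 1) = 4 * (k * k) - 5 * k + 1" "c * k = 4 * (k * k) - k"
  by (simp_all add: c_def algebra_simps)

lemma E_eq: "E = 4 * (k * n) + 4 * (k * k) - 4 * k + 1"
  by (simp add: E_def D_def ck)

lemma P_eq: "P = 8 * (k * n) - 2 * k + 1"
  by (simp add: P_def algebra_simps)

lemma P_E: "P = E + 2 * k * (2 * (n - k) + 1)"
  by (simp add: P_eq E_eq algebra_simps)

lemmas lin = ck D_def E_eq P_eq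

lemma P_pos: "0 < P"
  using kn k_pos by (simp add: P_eq)

lemma Z_win: "0 \<le> t \<Longrightarrow> t < P \<Longrightarrow> Z t \<longleftrightarrow> win t"
  by (simp add: Z_def)

lemma Z_shift [simp]: "Z (t + P) \<longleftrightarrow> Z t"
  by (simp add: Z_def)

lemma Z_cong: "t mod P = s mod P \<Longrightarrow> Z t \<longleftrightarrow> Z s"
  by (simp add: Z_def)

lemma cq_le: "q < j \<Longrightarrow> c * q + c \<le> c * j"
proof -
  assume "q < j"
  then have "c * (q + 1) \<le> c * j" using k_pos by (intro mult_left_mono) (auto simp: c_def)
  then show ?thesis by (simp add: algebra_simps)
qed

lemma cq_nonneg: "0 \<le> q \<Longrightarrow> 0 \<le> c * q"
  using k_pos by (simp add: c_def)

lemma mod_c: "0 \<le> r \<Longrightarrow> r < c \<Longrightarrow> (c * q + r) mod c = r"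
  by simp

lemma Z_left:
  assumes "0 \<le> q" "q < k" "0 \<le> r" "r < c"
  shows "Z (c * q + r) \<longleftrightarrow> r < k"
proof -
  have "c * q + r < c * k" using cq_le[of q k] assms by linarith
  moreover have "c * k < D" "D < P" using kn k_pos lin by linarith+
  moreover have "0 \<le> c * q + r" using cq_nonneg[of q] assms by linarith
  ultimately show ?thesis using mod_c[OF assms(3,4), of q] by (subst Z_win) (auto simp: win_def)
qed

lemma Z_gap:
  assumes "c * (k - 1) + k \<le> t" "t < D"
  shows "\<not> Z t"
proof -
  have "0 \<le> t" "t < P" using assms kn k_pos lin by linarith+
  moreover have "\<not> t mod c < k" if "t < c * k"
  proof -
    have "t mod c = t - c * (k - 1)"
      using that assms(1) k_pos mod_c[of "t - c * (k - 1)" "k - 1"] by (simp add: right_diff_distrib)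
    then show ?thesis using assms by simp
  qed
  ultimately show ?thesis using assms by (auto simp: Z_win win_def)
qed

lemma Z_tail:
  assumes "0 \<le> y" "E + y < P"
  shows "Z (E + y) \<longleftrightarrow> y mod (2 * k) < k"
proof -
  have "0 \<le> E" "D \<le> E" using kn k_pos lin cq_nonneg[of "k - 1"] E_def by linarith+
  then show ?thesis using assms by (subst Z_win) (auto simp: win_def)
qed

text \<open>The last block, \<open>q = k - 1\<close>, starts at \<open>E\<close> and already belongs
  to the tail, whose spacing is \<open>2 * k\<close> instead of \<open>c\<close>; hence the extra
  bound on \<open>r\<close> there.\<close>

lemma Z_right:
  assumes "0 \<le> q" "q < k" "0 \<le> r" "r < c" "q = k - 1 \<Longrightarrow> r < 2 * k"
  shows "Z (D + c * q + r) \<longleftrightarrow> r < k"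
proof (cases "q = k - 1")
  case True
  have "E + r < P" using assms(5)[OF True] kn k_pos lin by linarith
  then show ?thesis using Z_tail[of r] assms True by (simp add: E_def)
next
  case False
  then have "c * q + c \<le> c * (k - 1)" using cq_le[of q "k - 1"] assms by linarith
  then have "D + c * q + r < E" "E < P" using assms kn k_pos lin by linarith+
  moreover have "0 \<le> D + c * q + r" "\<not> D + c * q + r < D"
    using cq_nonneg[of q] assms kn k_pos lin by linarith+
  moreover have "(D + c * q + r - D) mod c = r" using mod_c[OF assms(3,4), of q] by (simp add: add.assoc)
  ultimately show ?thesis by (simp add: Z_win win_def)
qed

lemma tail_flip: "(y + k) mod (2 * k) < k \<longleftrightarrow> \<not> y mod (2 * k) < k" for y :: int
proof -
  define x where "x = y mod (2 * k)"
  have r: "0 \<le> x" "x < 2 * k" using k_pos by (auto simp: x_def)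
  have e: "(y + k) mod (2 * k) = (x + k) mod (2 * k)" by (simp only: x_def mod_add_left_eq)
  have "(x + k) mod (2 * k) = (if x < k then x + k else x - k)"
  proof (cases "x < k")
    case True
    then have "(x + k) mod (2 * k) = x + k" by (intro mod_pos_pos_trivial) (use r k_pos in linarith)+
    then show ?thesis using True by simp
  next
    case False
    have "(x + k) mod (2 * k) = (x - k + 2 * k) mod (2 * k)" by (simp add: add.commute)
    also have "\<dots> = (x - k) mod (2 * k)" by (rule mod_add_self2)
    finally show ?thesis using False r k_pos by simp
  qed
  then show ?thesis using r e unfolding x_def[symmetric] by auto
qed

lemma P_mod: "(P - E) mod (2 * k) = 0"
  by (simp add: P_E)

text \<open>A shift by \<open>k\<close> swaps the two halves of the tail period
  \<open>2 * k\<close>. This survives the wrap at \<open>P\<close>, because \<open>P - E\<close> is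
  a multiple of \<open>2 * k\<close> and the next period again opens with a block of
  \<open>k\<close> zeros.\<close>

lemma Z_tail_flip:
  assumes "0 \<le> y" "E + y < P"
  shows "Z (E + y + k) \<longleftrightarrow> \<not> Z (E + y)"
proof (cases "E + y + k < P")
  case True
  then show ?thesis using Z_tail[of y] Z_tail[of "y + k"] tail_flip[of y] assms k_pos
    by (simp add: add.assoc)
next
  case False
  define x where "x = E + y + k - P"
  have x: "0 \<le> x" "x < k" using False assms by (auto simp: x_def)
  have "Z (c * 0 + x)" using x k_pos by (subst Z_left) (auto simp: c_def)
  then have 1: "Z (E + y + k)" using Z_shift[of x] by (simp add: x_def)
  have "(y + k) mod (2 * k) = (x + (P - E)) mod (2 * k)" by (simp add: x_def)
  also have "\<dots> = x mod (2 * k)" using P_mod by (metis add.right_neutral mod_add_right_eq)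
  also have "\<dots> = x" using x by simp
  finally have "\<not> y mod (2 * k) < k" using tail_flip[of y] assms x by simp
  then show ?thesis using 1 Z_tail[of y] assms by simp
qed

section \<open>The recursion satisfied by the pattern\<close>

lemma split_c:
  assumes "0 \<le> t"
  obtains q r where "t = c * q + r" "0 \<le> q" "0 \<le> r" "r < c"
proof
  show "t = c * (t div c) + t mod c" by simp
qed (use assms k_pos in \<open>auto simp: c_def pos_imp_zdiv_nonneg_iff\<close>)

text \<open>The bound on \<open>t\<close> says exactly \<open>t + 4 * k * n < P\<close>, so no lag
  wraps around. Left blocks are compared with right blocks, and the gap with the tail.\<close>

lemma rule_low:
  assumes t: "0 \<le> t" "t \<le> D - 3 * k"
  shows "Z t \<longleftrightarrow> \<not> Z (t + k) \<and> \<not> Z (t + 4 * k * n - k) \<and> \<not> Z (t + 4 * k * n)"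
proof (cases "t < c * (k - 1) + k")
  case False
  define y where "y = t - c * (k - 1) - k"
  have y: "0 \<le> y" "E + y < P" using False t kn y_def lin by linarith+
  have e1: "t + 4 * k * n = E + y"
    by (simp add: y_def lin)
  have e2: "t + 4 * k * n - k = E + y - k" using e1 by simp
  have nt: "\<not> Z t" using Z_gap[of t] t False k_pos by simp
  \<comment> \<open>Points at distance \<open>k\<close> in the tail have opposite values; for
    \<open>y < k\<close> the point \<open>E + y\<close> lies in the first block.\<close>
  have "Z (E + y) \<or> Z (E + y - k)"
  proof (cases "y < k")
    case True
    then show ?thesis using Z_tail[OF y] y by simp
  next
    case False
    then show ?thesis using Z_tail_flip[of "y - k"] y k_pos by (auto simp: algebra_simps)
  qed
  then show ?thesis using nt e1 e2 by auto
next
  case True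
  obtain q r where qr: "t = c * q + r" "0 \<le> q" "0 \<le> r" "r < c" using split_c[OF t(1)] .
  have qk: "q < k"
  proof (rule ccontr)
    assume "\<not> q < k"
    then have "c * (k - 1) + c \<le> c * q" using cq_le[of "k - 1" q] by linarith
    then show False using True qr k_pos c_def by linarith
  qed
  have last: "r < k" if "q = k - 1" using True qr that by simp
  have e1: "t + 4 * k * n = D + c * q + (r - k)" "t + 4 * k * n - k = D + c * q + (r - 2 * k)"
    "t + k = c * q + (r + k)"
    using qr by (auto simp: D_def)
  have e2: "D + c * q + x = D + c * (q - 1) + (x + c)" for x
    by (simp add: algebra_simps)
  have e3: "c * q + x = c * (q + 1) + (x - c)" for x
    by (simp add: algebra_simps)
  \<comment> \<open>Since \<open>4 * k * n = D - k\<close>, the largest lag sends offset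
    \<open>r\<close> of left block \<open>q\<close> to offset \<open>r - k\<close> of right block
    \<open>q\<close>. In the four ranges a zero is found at \<open>t\<close>,
    \<open>t + 4 * k * n\<close>, \<open>t + 4 * k * n - k\<close>, and \<open>t + k\<close> (the
    next left block).\<close>
  consider "r < k" | "k \<le> r" "r < 2 * k" | "2 * k \<le> r" "r < 3 * k" | "3 * k \<le> r" by linarith
  then show ?thesis
  proof cases
    case 1
    have z: "Z t" using Z_left[of q r] qr qk 1 by simp
    have a: "\<not> Z (t + k)" unfolding e1 using Z_left[of q "r + k"] qr qk 1 k_pos by (simp add: c_def)
    have b: "\<not> Z (D + c * q + x)" if "x < 0" "-2 * k \<le> x" for x
    proof (cases "q = 0")
      case True
      then show ?thesis using that kn k_pos lin by (intro Z_gap; simp only: mult_zero_right; linarith)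
    next
      case False
      then show ?thesis unfolding e2
        using Z_right[of "q - 1" "x + c"] that qr qk k_pos by (simp add: c_def)
    qed
    have "\<not> Z (t + 4 * k * n)" unfolding e1 using b[of "r - k"] 1 qr k_pos by simp
    moreover have "\<not> Z (t + 4 * k * n - k)" unfolding e1(2) using b[of "r - 2 * k"] 1 qr k_pos by simp
    ultimately show ?thesis using z a by simp
  next
    case 2
    have "\<not> Z t" using Z_left[of q r] qr qk 2 by simp
    moreover have "Z (t + 4 * k * n)" unfolding e1
      using Z_right[of q "r - k"] qr qk 2 k_pos by (simp add: c_def)
    ultimately show ?thesis by simp
  next
    case 3
    have "\<not> Z t" using Z_left[of q r] qr qk 3 k_pos by simp
    moreover have "Z (t + 4 * k * n - k)" unfolding e1(2)
      using Z_right[of q "r - 2 * k"] qr qk 3 k_pos by (simp add: c_def)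
    ultimately show ?thesis by simp
  next
    case 4
    have "\<not> Z t" using Z_left[of q r] qr qk 4 k_pos by simp
    moreover have "Z (t + k)" unfolding e1 e3[of "r + k"]
      using Z_left[of "q + 1" "r + k - c"] qr qk 4 k_pos last by (cases "q = k - 1") (auto simp: c_def)
    ultimately show ?thesis by simp
  qed
qed

text \<open>Here the largest lag wraps around: \<open>x = t + 4 * k * n - P\<close>. Now right
  blocks are compared with left blocks, and the tail with the gap.\<close>

lemma rule_high:
  assumes t: "D - 3 * k < t" "t < P"
  shows "Z t \<longleftrightarrow> \<not> Z (t + k) \<and> \<not> Z (t + 4 * k * n - k) \<and> \<not> Z (t + 4 * k * n)"
proof -
  define x where "x = t - (D - 3 * k + 1)"
  have x: "0 \<le> x" "x < 4 * (k * n)" using t by (auto simp: x_def lin)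
  have z1: "Z (t + 4 * k * n) \<longleftrightarrow> Z x" using Z_shift[of x] by (simp add: x_def lin algebra_simps)
  have z2: "Z (t + 4 * k * n - k) \<longleftrightarrow> Z (x - k)"
    using Z_shift[of "x - k"] by (simp add: x_def lin algebra_simps)
  show ?thesis
  proof (cases "x < c * k")
    case False
    \<comment> \<open>Both long lags land in the gap, while \<open>t\<close> is at least
      \<open>E + k\<close>, so the flip by \<open>k\<close> alone decides.\<close>
    have "\<not> Z x" using False x kn k_pos lin by (intro Z_gap; linarith)
    moreover have "\<not> Z (x - k)" using False x kn k_pos lin by (intro Z_gap; linarith)
    moreover have "Z (t + k) \<longleftrightarrow> \<not> Z t"
      using Z_tail_flip[of "t - E"] t(2) False k_pos by (simp add: x_def lin)
    ultimately show ?thesis using z1 z2 by simp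
  next
    case True
    obtain q r where qr: "x = c * q + r" "0 \<le> q" "0 \<le> r" "r < c" using split_c[OF x(1)] .
    have qk: "q < k"
    proof (rule ccontr)
      assume "\<not> q < k"
      then have "c * (k - 1) + c \<le> c * q" using cq_le[of "k - 1" q] by linarith
      then have "c * k \<le> c * q" by (simp add: right_diff_distrib)
      then show False using True qr by linarith
    qed
    have te: "t = D + c * q + (r - 3 * k + 1)" using qr by (simp add: x_def)
    then have te': "t + k = D + c * q + (r - 2 * k + 1)" by simp
    have e2: "D + c * q + y = D + c * (q - 1) + (y + c)" for y
      by (simp add: algebra_simps)
    have neg: "\<not> Z (D + c * q + y)" if "y < 0" "-3 * k < y" for y
    proof (cases "q = 0")
      case True
      then show ?thesis using that kn k_pos lin by (intro Z_gap; simp only: mult_zero_right; linarith)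
    next
      case False
      then show ?thesis unfolding e2
        using Z_right[of "q - 1" "y + c"] that qr qk k_pos by (simp add: c_def)
    qed
    have xk: "x - k = c * q + (r - k)" using qr by simp
    \<comment> \<open>In turn a zero is found at \<open>t + 4 * k * n\<close>,
      \<open>t + 4 * k * n - k\<close>, \<open>t + k\<close> and \<open>t\<close>. The third range
      is one shorter because \<open>P\<close> exceeds a multiple of \<open>k\<close> by 1.\<close>
    consider "r < k" | "k \<le> r" "r < 2 * k" | "2 * k \<le> r" "r < 3 * k - 1" | "3 * k - 1 \<le> r"
      by linarith
    then show ?thesis
    proof cases
      case 1
      have "Z x" using Z_left[of q r] qr qk 1 by simp
      then show ?thesis using z1 neg[of "r - 3 * k + 1"] te qr 1 k_pos by simp
    next
      case 2
      have "Z (x - k)" using Z_left[of q "r - k"] qr qk 2 unfolding xk by simp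
      then show ?thesis using z2 neg[of "r - 3 * k + 1"] te qr 2 k_pos by simp
    next
      case 3
      have "Z (t + k)" using Z_right[of q "r - 2 * k + 1"] qr qk 3 k_pos unfolding te' by simp
      then show ?thesis using neg[of "r - 3 * k + 1"] te qr 3 k_pos by simp
    next
      case 4
      have "Z t" using Z_right[of q "r - 3 * k + 1"] qr qk 4 k_pos unfolding te by (simp add: c_def)
      moreover have "\<not> Z (t + k)"
        using Z_right[of q "r - 2 * k + 1"] qr qk 4 k_pos unfolding te' by (simp add: c_def)
      moreover have "\<not> Z x" using Z_left[of q r] qr qk 4 k_pos by simp
      moreover have "\<not> Z (x - k)" using Z_left[of q "r - k"] qr qk 4 k_pos unfolding xk by simp
      ultimately show ?thesis using z1 z2 by simp
    qed
  qed
qed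

lemma Z_rule: "Z t \<longleftrightarrow> \<not> Z (t + k) \<and> \<not> Z (t + 4 * k * n - k) \<and> \<not> Z (t + 4 * k * n)"
proof -
  define s where "s = t mod P"
  have s: "0 \<le> s" "s < P" using P_pos by (auto simp: s_def)
  have cong: "Z (t + x) \<longleftrightarrow> Z (s + x)" for x by (rule Z_cong) (simp add: s_def mod_add_left_eq)
  show ?thesis
    using rule_low[of s] rule_high[of s] s cong[of 0] cong[of k]
      cong[of "4 * k * n - k"] cong[of "4 * k * n"]
    by (cases "s \<le> D - 3 * k") (simp_all add: add_diff_eq)
qed

section \<open>Minimality of the period of the pattern\<close>

text \<open>
  Only the last zero before the long gap \<open>[c (k - 1) + k, D)\<close> passes these tests, so the zero set
  has no translational symmetry modulo \<open>P\<close>.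
\<close>

lemma Z_unique:
  assumes s: "0 \<le> s" "s < P" and Z: "Z s" "\<not> Z (s + 1)" "\<not> Z (s + k + 1)" "\<not> Z (s + 3 * k)"
  shows "s = c * (k - 1) + k - 1"
proof -
  have w: "win s" using Z(1) s by (simp add: Z_win)
  \<comment> \<open>As \<open>c = 4 * k - 1\<close>, a step of \<open>3 * k\<close> from the last
    point of a block (\<open>r = k - 1\<close>) hits the first point of the next one.\<close>
  have e3: "c * q + (r + 3 * k) = c * (q + 1) + (r - k + 1)" for q r
    by (simp add: c_def algebra_simps)
  consider (l) "s < D" | (r) "D \<le> s" "s < E" | (t) "E \<le> s" by linarith
  then show ?thesis
  proof cases
    case l
    obtain q r where qr: "s = c * q + r" "0 \<le> q" "0 \<le> r" "r < c" using split_c[OF s(1)] .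
    have "s < c * k" "s mod c < k" using w l by (auto simp: win_def)
    have r: "r < k" using \<open>s mod c < k\<close> qr mod_c[of r q] by simp
    have qk: "q < k"
    proof (rule ccontr)
      assume "\<not> q < k"
      then have "c * (k - 1) + c \<le> c * q" using cq_le[of "k - 1" q] by linarith
      then have "c * k \<le> c * q" by (simp add: right_diff_distrib)
      then show False using \<open>s < c * k\<close> qr by linarith
    qed
    have r2: "r = k - 1"
      using Z(2) Z_left[of q "r + 1"] qr qk r by (auto simp: c_def add.assoc)
    have "q = k - 1"
    proof (rule ccontr)
      assume "q \<noteq> k - 1"
      then have "Z (c * (q + 1) + 0)" using qr qk k_pos by (subst Z_left) (auto simp: c_def)
      then show False using Z(4) qr r2 e3[of q r] by (simp add: add.assoc)
    qed
    then show ?thesis using qr r2 by simp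
  next
    case r
    obtain q r where qr: "s - D = c * q + r" "0 \<le> q" "0 \<le> r" "r < c"
      using split_c[of "s - D"] r by auto
    have se: "s = D + c * q + r" using qr by simp
    have "(s - D) mod c < k" using w r by (auto simp: win_def)
    then have rk: "r < k" using qr mod_c[of r q] by simp
    have qk: "q < k - 1"
    proof (rule ccontr)
      assume "\<not> q < k - 1"
      then have "c * (k - 1) \<le> c * q" using k_pos by (intro mult_left_mono) (auto simp: c_def)
      then show False using r qr E_def by linarith
    qed
    have r2: "r = k - 1"
      using Z(2) Z_right[of q "r + 1"] qr qk rk se by (auto simp: c_def add.assoc)
    have "Z (D + c * (q + 1) + 0)" using qr qk k_pos by (subst Z_right) (auto simp: c_def)
    then show ?thesis using Z(4) se r2 e3[of q r] by (simp add: add.assoc)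
  next
    case t
    define y where "y = s - E"
    have y: "0 \<le> y" "E + y < P" "s = E + y" using t s by (auto simp: y_def)
    show ?thesis
    \<comment> \<open>In the tail one of \<open>s + 1\<close> and \<open>s + k + 1\<close> is a
      zero, unless \<open>s = P - 1\<close>; then \<open>s + 1\<close> wraps to the zero at
      \<open>0\<close>.\<close>
    proof (cases "E + (y + 1) < P")
      case True
      then have "Z (E + (y + 1) + k) \<longleftrightarrow> \<not> Z (E + (y + 1))" using y by (intro Z_tail_flip) auto
      then show ?thesis using Z y by (simp add: algebra_simps)
    next
      case False
      then have "s + 1 = 0 + P" using y s by simp
      then have "Z (s + 1) \<longleftrightarrow> Z (c * 0 + 0)" by (metis Z_shift mult_zero_right add_0)
      moreover have "Z (c * 0 + 0)" using k_pos by (subst Z_left) (auto simp: c_def)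
      ultimately show ?thesis using Z by simp
    qed
  qed
qed

lemma Z_marker:
  defines "s \<equiv> c * (k - 1) + k - 1"
  shows "0 \<le> s" "s < P" "Z s" "\<not> Z (s + 1)" "\<not> Z (s + k + 1)" "\<not> Z (s + 3 * k)"
proof -
  show "0 \<le> s" "s < P" using kn k_pos s_def lin by linarith+
  have "Z (c * (k - 1) + (k - 1))" using k_pos by (subst Z_left) (auto simp: c_def)
  then show "Z s" by (simp add: s_def add_diff_eq)
  show "\<not> Z (s + 1)" "\<not> Z (s + k + 1)" "\<not> Z (s + 3 * k)"
    using kn k_pos s_def lin by (intro Z_gap; linarith)+
qed

text \<open>A translation preserving \<open>Z\<close> preserves the tests of
  \<open>Z_unique\<close>, hence fixes their only solution modulo \<open>P\<close>.\<close>

lemma Z_period: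
  assumes "\<And>t. Z (t + h) \<longleftrightarrow> Z t"
  shows "P dvd h"
proof -
  define s where "s = c * (k - 1) + k - 1"
  note m = Z_marker[folded s_def]
  have cong: "Z ((s + h) mod P + x) \<longleftrightarrow> Z (s + x)" for x
  proof -
    have "Z ((s + h) mod P + x) \<longleftrightarrow> Z ((s + x) + h)"
      by (rule Z_cong) (metis mod_add_left_eq add.assoc add.commute)
    then show ?thesis using assms by simp
  qed
  have "(s + h) mod P = s"
    using m P_pos cong[of 0] cong[of 1] cong[of "k + 1"] cong[of "3 * k"]
    by (intro Z_unique[folded s_def]) (auto simp: add.assoc)
  then have "(s + h) mod P = s mod P" using m by simp
  then show ?thesis by (simp add: mod_eq_dvd_iff)
qed

section \<open>Multiples of \<open>k\<close>: cancellation and the values prescribed by the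
  seed\<close>

lemma coprime_P_k: "coprime P k"
proof (rule coprimeI)
  fix d assume d: "d dvd P" "d dvd k"
  have "P = k * (2 * (4 * n - 1)) + 1" by (simp add: P_def algebra_simps)
  then show "is_unit d" using d by (metis dvd_add_right_iff dvd_mult2)
qed

text \<open>The strand index \<open>-m\<close> has coordinate \<open>k * m\<close>, which stays
  below \<open>D\<close> for seed indices, so only left blocks matter.\<close>

lemma Z_seed:
  assumes "1 \<le> m" "m \<le> 4 * n"
  shows "Z (k * m) \<longleftrightarrow> (\<exists>a. 1 \<le> a \<and> a < k \<and> m = 4 * a)"
proof
  assume Z: "Z (k * m)"
  have km: "0 \<le> k * m" "k * m \<le> 4 * (k * n)"
    using assms k_pos mult_left_mono[of m "4 * n" k] by (auto simp: mult.left_commute)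
  then have "k * m < D" "k * m < P" using kn k_pos lin by linarith+
  then have w: "k * m < c * k" "(k * m) mod c < k"
    using Z Z_win[of "k * m"] km(1) by (auto simp: win_def)
  define a s where "a = m div 4" and "s = m mod 4"
  have as: "m = 4 * a + s" "0 \<le> s" "s < 4" by (auto simp: a_def s_def)
  have mc: "m < 4 * k - 1" using w k_pos by (simp add: c_def mult.commute)
  \<comment> \<open>From \<open>4 * k = c + 1\<close>: four strand steps advance one block and drift
    by 1 inside it.\<close>
  have e: "k * m = c * a + (a + s * k)" by (simp add: as c_def algebra_simps)
  have "a + s * k < c"
  proof (cases "s = 3")
    case True
    then show ?thesis using as mc by (auto simp: c_def)
  next
    case False
    then have "s * k \<le> 2 * k" using as k_pos by (intro mult_right_mono) auto
    then show ?thesis using as mc k_pos c_def by linarith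
  qed
  moreover have "0 \<le> s * k" "0 \<le> a" using as k_pos assms by auto
  ultimately have "a + s * k < k" using w(2) mod_c[of "a + s * k" a] e by auto
  then have "s = 0" using as \<open>0 \<le> a\<close> k_pos
    by (smt (verit) mult_le_cancel_right1)
  then show "\<exists>a. 1 \<le> a \<and> a < k \<and> m = 4 * a"
    using as \<open>a + s * k < k\<close> assms by (intro exI[of _ a]) auto
next
  assume "\<exists>a. 1 \<le> a \<and> a < k \<and> m = 4 * a"
  then obtain a where a: "1 \<le> a" "a < k" "m = 4 * a" by auto
  have "k * m = c * a + a" by (simp add: a c_def algebra_simps)
  moreover have "Z (c * a + a)" using a by (subst Z_left) (auto simp: c_def)
  ultimately show "Z (k * m)" by simp
qed

end

section \<open>The sequence in terms of its strands\<close>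

lemma nth_concat_blocks:
  assumes "\<forall>x\<in>set xs. length x = b" "q < length xs" "t < b"
  shows "concat xs ! (q * b + t) = xs ! q ! t"
  using assms
proof (induction xs arbitrary: q)
  case (Cons x xs)
  then show ?case by (cases q) (auto simp: nth_append add.assoc)
qed simp

lemma quot_rem_unique:
  fixes b :: nat
  assumes "b * q + s = b * q' + s'" "s < b" "s' < b"
  shows "q = q' \<and> s = s'"
proof -
  have "(b * q + s) div b = (b * q' + s') div b" "(b * q + s) mod b = (b * q' + s') mod b"
    using assms(1) by simp_all
  then show ?thesis using assms(2,3) by simp
qed

section \<open>Layout of the padded seed\<close>

lemma int_b_num: "1 \<le> n \<Longrightarrow> int (b_num n) = 4 * int n - 1"
  by (simp add: b_num_def of_nat_diff)

lemma Max_A_set: "1 \<le> n \<Longrightarrow> Max (A_set n) = 4 * n * n"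
proof -
  assume n: "1 \<le> n"
  then have "n \<le> n * b_num n" by (simp add: b_num_def)
  then have "Max (A_set n) = n * b_num n + n" by (auto simp: A_set_def max_def)
  also have "\<dots> = 4 * n * n" using n by (simp add: b_num_def algebra_simps)
  finally show ?thesis .
qed

text \<open>The padding consists of \<open>n + b_num n\<close> ones; the last \<open>b_num n\<close>
  of them serve as a block for \<open>j = 0\<close>, leaving \<open>n\<close> ones in front of
  \<open>n\<close> blocks of equal length.\<close>

lemma pad_seed_eq:
  assumes "1 \<le> n"
  shows "pad_seed (A_set n) (seed n) = replicate n 1 @
    concat (map (\<lambda>j. replicate j 0 @ replicate (b_num n - j) 1) [0..<n])"
proof -
  have "length (seed n) = (n - 1) * b_num n"
  proof -
    have "sum_list (map (\<lambda>j. j + (b_num n - j)) [1..<n]) = sum_list (map (\<lambda>j. b_num n) [1..<n])"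
      by (intro arg_cong[of _ _ sum_list] map_cong) (auto simp: b_num_def)
    then show ?thesis by (simp add: seed_def length_concat comp_def sum_list_triv)
  qed
  moreover have "4 * n * n = n + b_num n + (n - 1) * b_num n"
    using assms by (cases n) (auto simp: b_num_def algebra_simps)
  ultimately have "Max (A_set n) - length (seed n) = n + b_num n"
    using Max_A_set[OF assms] by simp
  then show ?thesis using assms
    by (simp add: pad_seed_def seed_def replicate_add upt_conv_Cons[of 0 n])
qed

lemma pad_seed_nth:
  assumes "1 \<le> n" "p < 4 * n * n"
  shows "pad_seed (A_set n) (seed n) ! p =
    (if \<exists>j t. t < j \<and> j < n \<and> p = n + j * b_num n + t then 0 else 1)"
proof (cases "p < n")
  case True
  then show ?thesis using assms by (auto simp: pad_seed_eq nth_append)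
next
  case False
  let ?b = "b_num n"
  define q s where "q = (p - n) div ?b" and "s = (p - n) mod ?b"
  have b: "n \<le> ?b" "0 < ?b" using assms(1) by (auto simp: b_num_def)
  have p: "p = n + q * ?b + s" "s < ?b" using False b by (auto simp: q_def s_def)
  have "n * ?b + n = 4 * n * n" using assms(1) by (simp add: b_num_def algebra_simps)
  then have "q * ?b < n * ?b" using p assms by linarith
  then have q: "q < n" by simp
  have "pad_seed (A_set n) (seed n) ! p =
      concat (map (\<lambda>j. replicate j 0 @ replicate (?b - j) 1) [0..<n]) ! (q * ?b + s)"
    using assms p by (simp add: pad_seed_eq nth_append)
  also have "\<dots> = (if s < q then 0 else 1)"
    using p q b by (subst nth_concat_blocks[where b = ?b]) (auto simp: nth_append)
  also have "s < q \<longleftrightarrow> (\<exists>j t. t < j \<and> j < n \<and> p = n + j * ?b + t)"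
  proof
    assume "\<exists>j t. t < j \<and> j < n \<and> p = n + j * ?b + t"
    then obtain j t where jt: "t < j" "j < n" "q * ?b + s = j * ?b + t" using p by auto
    then have "t < ?b" using b by simp
    then have "q = j \<and> s = t" using quot_rem_unique[of ?b q s j t] jt(3) p(2) by (simp add: mult.commute)
    then show "s < q" using jt by simp
  qed (use p q in auto)
  finally show ?thesis .
qed

section \<open>Closed form of the sequence\<close>

lemma wseq_rule:
  fixes S
  assumes "1 \<le> n" "0 \<le> i"
  defines "w \<equiv> wseq (A_set n) S"
  assumes "w (i - int n) = (if z1 then 0 else 1)"
    "w (i - int n * (4 * int n - 1)) = (if z2 then 0 else 1)"
    "w (i - int n * (4 * int n)) = (if z3 then 0 else 1)"
  shows "w i = (if \<not> z1 \<and> \<not> z2 \<and> \<not> z3 then 0 else 1)"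
proof -
  have e: "int (n * b_num n) = int n * (4 * int n - 1)"
    "int (n * b_num n + n) = int n * (4 * int n)"
    using assms(1) by (auto simp: b_num_def of_nat_diff algebra_simps)
  have "0 \<notin> A_set n" using assms(1) by (auto simp: A_set_def b_num_def)
  then have "w i = 1 - Min ((\<lambda>x. w (i - int x)) ` A_set n)"
    unfolding w_def using assms(2) by (subst wseq.simps) simp
  also have "(\<lambda>x. w (i - int x)) ` A_set n =
      {w (i - int n), w (i - int n * (4 * int n - 1)), w (i - int n * (4 * int n))}"
    by (simp only: A_set_def image_insert image_empty e)
  finally show ?thesis using assms(4-) by (auto simp: min_def)
qed

text \<open>Strong induction from the start of the seed at \<open>m = - 4 * int n\<close>: negative
  \<open>m\<close> compare the seed with \<open>Z_seed\<close>, and for the others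
  \<open>Z_rule\<close> mirrors the recursion.\<close>

lemma wseq_closed_form:
  assumes "r < n" "- 4 * int n \<le> m"
  shows "wseq (A_set n) (seed n) (int n * m + int r) =
    (if strand.Z (int n) (int r + 1) (- (int r + 1) * m) then 0 else 1)"
  using assms(2)
proof (induction "nat (m + 4 * int n)" arbitrary: m rule: less_induct)
  case less
  define k where "k = int r + 1"
  interpret strand "int n" k using assms(1) by unfold_locales (auto simp: k_def)
  have n: "1 \<le> n" using assms(1) by simp
  show ?case unfolding k_def[symmetric]
  proof (cases "0 \<le> m")
    case True
    let ?i = "int n * m + int r"
    let ?w = "wseq (A_set n) (seed n)"
    have IH: "?w (int n * (m - x) + int r) = (if Z (- k * (m - x)) then 0 else 1)"
      if "0 < x" "x \<le> 4 * int n" for x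
      using less.hyps[of "m - x"] that True unfolding k_def by simp
    have "?w ?i = (if \<not> Z (- k * (m - 1)) \<and> \<not> Z (- k * (m - (4 * int n - 1))) \<and>
        \<not> Z (- k * (m - 4 * int n)) then 0 else 1)"
      using n True IH[of 1] IH[of "4 * int n - 1"] IH[of "4 * int n"]
      by (intro wseq_rule) (auto simp: algebra_simps)
    then show "?w ?i = (if Z (- k * m) then 0 else 1)"
      using Z_rule[of "- k * m"] by (simp add: algebra_simps)
  next
    case False
    define M where "M = nat (m + 4 * int n)"
    have M: "m = int M - 4 * int n" "M < 4 * n" using less.prems False by (auto simp: M_def)
    have "int n * m \<le> int n * (-1)" using False by (intro mult_left_mono) auto
    then have neg: "int n * m + int r < 0" using assms(1) by simp
    have "n * (M + 1) \<le> n * (4 * n)" using M by (intro mult_left_mono) auto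
    then have pos: "n * M + r < 4 * n * n" using assms(1) by (simp add: algebra_simps)
    have "int n * m + int r + int (Max (A_set n)) = int (n * M + r)"
      using Max_A_set[OF n] unfolding M by (simp add: algebra_simps)
    then have "wseq (A_set n) (seed n) (int n * m + int r) = pad_seed (A_set n) (seed n) ! (n * M + r)"
      using neg by (subst wseq.simps) (simp only: if_True nat_int)
    moreover have "(\<exists>j t. t < j \<and> j < n \<and> n * M + r = n + j * b_num n + t) \<longleftrightarrow>
        (\<exists>a. 1 \<le> a \<and> a < k \<and> - m = 4 * a)"
    proof
      assume "\<exists>j t. t < j \<and> j < n \<and> n * M + r = n + j * b_num n + t"
      then obtain j t where jt: "t < j" "j < n" "n * M + r = n + j * b_num n + t" by blast
      \<comment> \<open>Blocks are one short of \<open>4 * n\<close>, so block \<open>j\<close> is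
        displaced by \<open>j\<close>. Division by \<open>n\<close> then reads off
        \<open>M = 4 * j\<close> and \<open>r = n - (j - t)\<close>, which corresponds to
        \<open>a = n - j\<close>.\<close>
      have "j * b_num n + j = n * (4 * j)" using n by (simp add: b_num_def algebra_simps)
      then have e: "n * M + r = n * (4 * j) + (n - (j - t))" using jt by simp
      have "n - (j - t) < n" using jt by simp
      then have "M = 4 * j \<and> r = n - (j - t)" using e assms(1)
        by (intro quot_rem_unique) auto
      then show "\<exists>a. 1 \<le> a \<and> a < k \<and> - m = 4 * a"
        using jt M by (intro exI[of _ "int n - int j"]) (auto simp: k_def)
    next
      assume "\<exists>a. 1 \<le> a \<and> a < k \<and> - m = 4 * a"
      then obtain a where a: "1 \<le> a" "a < k" "- m = 4 * a" by blast
      then have a: "1 \<le> a" "a \<le> int r" "int M + 4 * a = 4 * int n" using M k_def by linarith+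
      define j where "j = n - nat a"
      have j: "int j = int n - a" "j < n" "M = 4 * j" using a assms(1) by (auto simp: j_def)
      have "j * b_num n + j = n * M" using n j by (simp add: b_num_def algebra_simps)
      moreover have "n \<le> j + r" using a j by linarith
      ultimately have "n * M + r = n + j * b_num n + (j + r - n)" by linarith
      then show "\<exists>j t. t < j \<and> j < n \<and> n * M + r = n + j * b_num n + t"
        using j assms(1) \<open>n \<le> j + r\<close> by (intro exI[of _ j] exI[of _ "j + r - n"]) auto
    qed
    moreover have "Z (- k * m) \<longleftrightarrow> (\<exists>a. 1 \<le> a \<and> a < k \<and> - m = 4 * a)"
      using Z_seed[of "- m"] False less.prems by simp
    ultimately show "wseq (A_set n) (seed n) (int n * m + int r) = (if Z (- k * m) then 0 else 1)"
      using pad_seed_nth[OF n pos] by simp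
  qed
qed

section \<open>Periods of the sequence and of its strands\<close>

text \<open>Ensures that the \<open>LEAST\<close> in \<open>per\<close> is attained: a shift by
  \<open>n * Q\<close> moves every strand by \<open>Q\<close>, a multiple of its period.\<close>

lemma wseq_periodic:
  assumes "1 \<le> n"
  shows "\<exists>p. periodic_over (\<lambda>i. wseq (A_set n) (seed n) (int i)) p"
proof -
  define Q where "Q = (\<Prod>k\<in>{1..n}. 2 * k * b_num n + 1)"
  have "wseq (A_set n) (seed n) (int (i + n * Q)) = wseq (A_set n) (seed n) (int i)" for i
  proof -
    define r m where "r = i mod n" and "m = i div n"
    define k where "k = int r + 1"
    have r: "r < n" "i = n * m + r" using assms by (auto simp: r_def m_def)
    interpret strand "int n" k using r by unfold_locales (auto simp: k_def)
    have "2 * (r + 1) * b_num n + 1 dvd Q" unfolding Q_def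
      by (rule dvd_prodI) (use r in auto)
    moreover have "int (2 * (r + 1) * b_num n + 1) = P"
      using assms unfolding P_def by (simp add: k_def int_b_num ring_distribs)
    ultimately have "P dvd int Q" by (metis int_dvd_int_iff)
    then obtain x where x: "int Q = P * x" by (elim dvdE)
    have "- k * (int m + int Q) = - k * int m + P * (- k * x)"
      by (simp add: x algebra_simps)
    then have "(- k * (int m + int Q)) mod P = (- k * int m) mod P"
      by (simp only: mod_mult_self2)
    then have "Z (- k * (int m + int Q)) \<longleftrightarrow> Z (- k * int m)" by (rule Z_cong)
    then show ?thesis
      using wseq_closed_form[OF r(1), of "int m"] wseq_closed_form[OF r(1), of "int m + int Q"] r(2)
      unfolding k_def by (simp add: algebra_simps)
  qed
  moreover have "1 \<le> n * Q" using assms by (simp add: Q_def Suc_le_eq)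
  ultimately show ?thesis unfolding periodic_over_def by metis
qed

lemma strand_period_dvd:
  assumes "periodic_over (\<lambda>i. wseq (A_set n) (seed n) (int i)) p" and "1 \<le> k" "k \<le> n"
  shows "2 * k * b_num n + 1 dvd p"
proof -
  let ?w = "\<lambda>i. wseq (A_set n) (seed n) (int i)"
  define r where "r = k - 1"
  have r: "r < n" "int r + 1 = int k" using assms by (auto simp: r_def)
  interpret strand "int n" "int k" using assms by unfold_locales auto
  obtain N where N: "\<And>i. N \<le> i \<Longrightarrow> ?w i = ?w (i + p)"
    using assms(1) by (auto simp: periodic_over_def)
  have step: "?w (i + x * p) = ?w i" if "N \<le> i" for i x
  proof (induction x)
    case (Suc x)
    then show ?case using N[of "i + x * p"] that by (simp add: algebra_simps)
  qed simp
  have cf: "Z (- int k * int m) \<longleftrightarrow> ?w (n * m + r) = 0" for m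
    using wseq_closed_form[OF r(1), of "int m"] r(2) by simp
  \<comment> \<open>Moving a strand by \<open>p\<close> moves the sequence by \<open>n * p\<close>,
    that is, by \<open>n\<close> periods.\<close>
  have shift: "Z (- int k * int (m + p)) \<longleftrightarrow> Z (- int k * int m)" if "N \<le> m" for m
  proof -
    have "1 * m \<le> n * m" using r by (intro mult_right_mono) auto
    then have "N \<le> n * m + r" using that by linarith
    then have "?w (n * (m + p) + r) = ?w (n * m + r)" using step[of "n * m + r" n]
      by (simp only: distrib_left add.assoc add.commute add.left_commute)
    then show ?thesis unfolding cf by simp
  qed
  have "Z (t + - int k * int p) \<longleftrightarrow> Z t" for t
  proof -
    define b where "b = 4 * int n - 1"
    define B where "B = \<bar>2 * b * t\<bar> + int N"
    \<comment> \<open>Since \<open>- k * (2 * b) = 1 - P\<close>, this \<open>m\<close> has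
      coordinate \<open>t\<close> modulo \<open>P\<close>; the multiple \<open>P * B\<close> pushes
      it beyond \<open>N\<close>.\<close>
    define m where "m = nat (2 * b * t + P * B)"
    have "1 * B \<le> P * B" using P_pos by (intro mult_right_mono) (auto simp: B_def)
    then have "int N \<le> 2 * b * t + P * B" using B_def by linarith
    then have m: "int m = 2 * b * t + P * B" "N \<le> m"
      unfolding m_def by (simp_all add: le_nat_iff)
    have "- int k * int m = t + P * (- t - int k * B)"
      unfolding m P_def b_def[symmetric] by (simp add: algebra_simps)
    then have "- int k * int m + x = t + x + P * (- t - int k * B)" for x by linarith
    then have "(- int k * int m + x) mod P = (t + x) mod P" for x
      by (simp only: mod_mult_self2)
    then have "Z (- int k * int m + x) \<longleftrightarrow> Z (t + x)" for x by (rule Z_cong)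
    from this[of 0] this[of "- int k * int p"] show ?thesis
      using shift[OF m(2)] by (simp add: algebra_simps)
  qed
  then have "P dvd - int k * int p" by (rule Z_period)
  then have "P dvd int k * int p" by simp
  then have "P dvd int p" using coprime_P_k by (simp add: coprime_dvd_mult_right_iff)
  moreover have "P = int (2 * k * b_num n + 1)"
    using r(1) by (simp add: P_def b_num_def of_nat_diff)
  ultimately show ?thesis by (metis int_dvd_int_iff)
qed

section \<open>Common multiples of an arithmetic progression\<close>

text \<open>Induction on the two subprogressions that omit the last or the first term; the
  difference of these two terms supplies the new factor \<open>d * (l + 1)\<close>.\<close>

lemma prod_arith_progression_dvd:
  fixes a d L :: int
  assumes "\<And>j. j \<le> l \<Longrightarrow> a + d * int j dvd L"
  shows "(\<Prod>j\<le>l. a + d * int j) dvd fact l * d ^ l * L"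
  using assms
proof (induction l arbitrary: a)
  case 0
  then show ?case by simp
next
  case (Suc l)
  define u where "u = a + d * int (Suc l)"
  define Q where "Q = (\<Prod>j<l. a + d * int (Suc j))"
  define X where "X = fact l * d ^ l * L"
  have low: "(\<Prod>j\<le>l. a + d * int j) = a * Q"
    unfolding Q_def lessThan_Suc_atMost[symmetric] prod.lessThan_Suc_shift by simp
  have high: "(\<Prod>j\<le>l. (a + d) + d * int j) = Q * u"
    unfolding Q_def u_def lessThan_Suc_atMost[symmetric] prod.lessThan_Suc by (simp add: algebra_simps)
  have all: "(\<Prod>j\<le>Suc l. a + d * int j) = a * Q * u"
    unfolding prod.atMost_Suc low u_def ..
  have "a * Q dvd X" unfolding X_def low[symmetric] by (rule Suc.IH) (use Suc.prems in auto)
  then have 1: "a * Q * u dvd X * u" by (rule mult_dvd_mono) simp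
  have "Q * u dvd X" unfolding X_def high[symmetric]
  proof (rule Suc.IH)
    fix j assume "j \<le> l"
    then show "a + d + d * int j dvd L" using Suc.prems[of "Suc j"] by (simp add: algebra_simps)
  qed
  then have 2: "a * Q * u dvd a * X" by (simp add: mult.assoc)
  have "fact (Suc l) * d ^ Suc l * L = X * u - a * X"
    by (simp add: X_def u_def algebra_simps)
  then show ?case using dvd_diff[OF 1 2] all by simp
qed

text \<open>The terms are coprime to \<open>d\<close>, so the power of \<open>d\<close> cancels and
  the product is at most \<open>(n - 1)! * L\<close>; it is also at least
  \<open>d ^ n * n!\<close>.\<close>

lemma common_multiple_ge:
  fixes d L n :: nat
  assumes "1 \<le> n" "0 < L" and dvd: "\<And>k. 1 \<le> k \<Longrightarrow> k \<le> n \<Longrightarrow> d * k + 1 dvd L"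
  shows "d ^ n \<le> L"
proof -
  obtain l where l: "n = Suc l" using assms(1) by (cases n) auto
  let ?p = "\<Prod>j\<le>l. int d + 1 + int d * int j"
  have "?p dvd fact l * int d ^ l * int L"
  proof (rule prod_arith_progression_dvd)
    fix j assume "j \<le> l"
    then have "int (d * Suc j + 1) dvd int L" using dvd[of "Suc j"] l by (simp only: int_dvd_int_iff)
    then show "int d + 1 + int d * int j dvd int L" by (simp add: algebra_simps)
  qed
  then have "?p dvd int d ^ l * (fact l * int L)" by (simp add: ac_simps)
  moreover have "coprime ?p (int d ^ l)"
  proof (intro prod_coprime_left)
    fix j
    have "coprime (int d * (1 + int j) + 1) (int d)"
      by (rule coprimeI) (metis dvd_add_right_iff dvd_mult2)
    then show "coprime (int d + 1 + int d * int j) (int d ^ l)"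
      by (simp add: algebra_simps)
  qed
  ultimately have "?p dvd fact l * int L" by (simp add: coprime_dvd_mult_right_iff)
  then have le: "?p \<le> fact l * int L" using assms(2) by (intro zdvd_imp_le) auto
  have "int d ^ n * fact n = (\<Prod>j\<le>l. int d * (int j + 1))"
    unfolding l lessThan_Suc_atMost[symmetric] prod.distrib
    by (simp add: fact_prod_Suc atLeast0LessThan algebra_simps)
  also have "\<dots> \<le> ?p" by (intro prod_mono) (auto simp: algebra_simps)
  also note le
  also have "fact l * int L \<le> int L * fact n"
    by (simp add: l mult_right_mono algebra_simps)
  finally have "int d ^ n \<le> int L" by simp
  then show ?thesis by (metis of_nat_le_iff of_nat_power)
qed

theorem theorem6p2:
  "\<exists>c::real. c > 0 \<and>
     (\<exists>n0\<ge>1. \<forall>n\<ge>n0. real (per (A_set n) (seed n)) \<ge> exp (c * sqrt (real (Max (A_set n)))))"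
proof (intro exI[of _ "1/2 :: real"] conjI exI[of _ "1 :: nat"] allI impI)
  fix n :: nat assume n: "1 \<le> n"
  let ?p = "per (A_set n) (seed n)"
  have per: "periodic_over (\<lambda>i. wseq (A_set n) (seed n) (int i)) ?p"
    unfolding per_def using wseq_periodic[OF n] by (rule LeastI_ex)
  then have "0 < ?p" by (simp add: periodic_over_def)
  then have ge: "(2 * b_num n) ^ n \<le> ?p"
    by (rule common_multiple_ge[OF n]) (use strand_period_dvd[OF per] in \<open>simp add: ac_simps\<close>)
  have "sqrt (real (Max (A_set n))) = 2 * real n"
    by (simp add: Max_A_set[OF n] real_sqrt_mult)
  then have "1/2 * sqrt (real (Max (A_set n))) = real n * 1" by simp
  then have "exp (1/2 * sqrt (real (Max (A_set n)))) = exp 1 ^ n" by (simp only: exp_of_nat_mult)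
  \<comment> \<open>\<open>2 * b_num n\<close> is at least 6, and \<open>exp 1\<close> is at most
    3.\<close>
  also have "\<dots> \<le> (2 * real (b_num n)) ^ n"
    using exp_le n by (intro power_mono) (auto simp: b_num_def of_nat_diff)
  also have "\<dots> \<le> real ?p" using ge by (metis of_nat_le_iff of_nat_mult of_nat_numeral of_nat_power)
  finally show "exp (1/2 * sqrt (real (Max (A_set n)))) \<le> real ?p" .
qed auto

end
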